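(* Let $R\in(0,1)$ be the positive root of the equation $3x+2\log(1-x)=0$; numerically $R=0.5828\ldots$. Then for every $f(z)=\sum_{n=0}^{\infty}a_nz^n\in\mathcal{B}$ and every $r$ with $0\le r\le R$, $$\sum_{n=0}^{\infty}\frac{|a_n|}{n+1}\,r^n\le 1 .$$ Moreover, $R$ is the best possible: there is no $R'\in(R,1)$ such that this inequality holds for all $f\in\mathcal{B}$ and all $0\le r\le R'$.
   Context: $\mathbb{D}=\{z\in\mathbb{C}:|z|<1\}$ is the open unit disk, and $\mathcal{B}$ is the set of all analytic functions $f$ on $\mathbb{D}$ with $|f(z)|\le 1$ for all $z\in\mathbb{D}$. $\log$ is the natural logarithm. The notation $R=0.5828\ldots$ means that the decimal expansion of $R$ begins with these digits. *)

theory Defs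
  imports "HOL-Complex_Analysis.Complex_Analysis"
begin

(* Functions are total in HOL; values outside the unit disk are irrelevant. *)
definition unit_disk_class :: "(complex \<Rightarrow> complex) set" where
  "unit_disk_class =
     {f. f analytic_on ball 0 1 \<and> (\<forall>z \<in> ball 0 1. norm (f z) \<le> 1)}"

definition power_series_on_disk :: "(nat \<Rightarrow> complex) \<Rightarrow> (complex \<Rightarrow> complex) \<Rightarrow> bool" where
  "power_series_on_disk a f \<longleftrightarrow> (\<forall>z \<in> ball 0 1. (\<lambda>n. a n * z ^ n) sums f z)"

end

theory Submission imports Defs begin

text \<open>Schwarz--Pick gives \<open>|a\<^sub>n| \<le> 1 - A\<^sup>2\<close> for \<open>n \<ge> 1\<close>, where \<open>A = |a\<^sub>0|\<close>, so the weighted sum is at most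
  \<open>A + (1 - A\<^sup>2) S r\<close> with \<open>S r = (\<Sum>n\<ge>1. r\<^sup>n / (n + 1)) = - ln (1 - r) / r - 1\<close>. The function \<open>S\<close> is strictly
  increasing and the equation for \<open>R\<close> says \<open>S R = 1/2\<close>; if \<open>S r \<le> 1/2\<close> the bound is at most
  \<open>1 - (1 - A)\<^sup>2 / 2 \<le> 1\<close>. If \<open>S r > 1/2\<close>, the Moebius map \<open>(c - z) / (1 - c z)\<close> violates the inequality
  for \<open>c\<close> close to \<open>1\<close>.\<close>

section \<open>The coefficient inequality\<close>

text \<open>Composing with the disk automorphism that moves the value at the origin to 0 reduces the
  bound to the Schwarz lemma.\<close>

lemma Schwarz_Pick_coeff:
  fixes h :: "complex \<Rightarrow> complex"
  assumes hol: "h holomorphic_on ball 0 1"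
    and le: "\<And>z. norm z < 1 \<Longrightarrow> norm (h z) \<le> 1"
  shows "norm (deriv h 0) \<le> 1 - (norm (h 0))\<^sup>2"
proof -
  \<comment> \<open>Shrinking by \<open>t\<close> puts the values into the open disk, so that
    \<open>norm w < 1\<close> holds even when \<open>norm (h 0) = 1\<close>.\<close>
  have scaled: "t * norm (deriv h 0) \<le> 1 - (t * norm (h 0))\<^sup>2" if t: "0 < t" "t < 1" for t :: real
  proof -
    define g where "g = (\<lambda>z. of_real t * h z)"
    define w where "w = g 0"
    define F where "F = Moebius_function 0 w \<circ> g"
    have g_lt: "norm (g z) < 1" if "norm z < 1" for z
    proof -
      have "norm (g z) = t * norm (h z)"
        using t by (simp add: g_def norm_mult)
      also have "\<dots> \<le> t * 1"
        using t le[OF that] by (intro mult_left_mono) auto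
      finally show ?thesis using t by simp
    qed
    have w1: "norm w < 1"
      using g_lt[of 0] by (simp add: w_def)
    have g_hol: "g holomorphic_on ball 0 1"
      unfolding g_def by (intro holomorphic_intros hol)
    have "g ` ball 0 1 \<subseteq> ball 0 1"
      using g_lt by auto
    then have F_hol: "F holomorphic_on ball 0 1"
      unfolding F_def
      using holomorphic_on_compose_gen[OF g_hol Moebius_function_holomorphic[OF w1]] by blast
    have F0: "F 0 = 0"
      by (simp add: F_def Moebius_function_eq_zero flip: w_def)
    have F_lt: "norm (F z) < 1" if "norm z < 1" for z
      unfolding F_def o_def by (rule Moebius_function_norm_lt_1[OF w1 g_lt[OF that]])
    have F'_le: "norm (deriv F 0) \<le> 1"
      by (rule Schwarz_Lemma(2)[OF F_hol F0 F_lt, of 0]) auto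
    have w2: "cnj w * w = of_real ((norm w)\<^sup>2)"
      by (metis complex_norm_square mult.commute)
    have lt1: "(norm w)\<^sup>2 < 1"
      using w1 by (simp add: power_less_one_iff abs_square_less_1)
    have nz: "1 - cnj w * w \<noteq> 0"
      using lt1 unfolding w2 by (metis of_real_1 of_real_diff of_real_eq_0_iff less_numeral_extra(4) right_minus_eq)
    have h': "(h has_field_derivative deriv h 0) (at 0)"
      by (rule holomorphic_derivI[OF hol open_ball]) simp
    have g': "(g has_field_derivative of_real t * deriv h 0) (at 0)"
      unfolding g_def by (rule DERIV_cmult[OF h'])
    \<comment> \<open>Quotient rule: at 0 the summand with factor \<open>g 0 - w\<close> vanishes
      and one factor \<open>1 - cnj w * w\<close> of the denominator cancels.\<close>
    have "(F has_field_derivative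
        ((of_real t * deriv h 0) * (1 - cnj w * g 0) - (g 0 - w) * - (cnj w * (of_real t * deriv h 0)))
          / ((1 - cnj w * g 0) * (1 - cnj w * g 0))) (at 0)"
      unfolding F_def o_def Moebius_function_simple
      by (rule derivative_eq_intros g' refl | use nz in \<open>simp add: w_def\<close>)+
    then have "deriv F 0 = of_real t * deriv h 0 / (1 - cnj w * w)"
      using nz by (simp add: DERIV_imp_deriv flip: w_def)
    also have "\<dots> = of_real t * deriv h 0 / of_real (1 - (norm w)\<^sup>2)"
      by (simp add: w2)
    finally have "norm (deriv F 0) = t * norm (deriv h 0) / (1 - (norm w)\<^sup>2)"
      using t lt1 by (simp add: norm_divide norm_mult del: of_real_diff of_real_power)
    then have "t * norm (deriv h 0) \<le> 1 - (norm w)\<^sup>2"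
      using F'_le lt1 by simp
    moreover have "norm w = t * norm (h 0)"
      using t by (simp add: w_def g_def norm_mult)
    ultimately show ?thesis by simp
  qed
  \<comment> \<open>Both sides of \<open>scaled\<close> are continuous in \<open>t\<close>, so the
    bound for \<open>h\<close> itself follows as \<open>t\<close> tends to 1 from the left.\<close>
  have "((\<lambda>t. t * norm (deriv h 0)) \<longlongrightarrow> 1 * norm (deriv h 0)) (at_left 1)"
    "((\<lambda>t. 1 - (t * norm (h 0))\<^sup>2) \<longlongrightarrow> 1 - (1 * norm (h 0))\<^sup>2) (at_left 1)"
    by (intro tendsto_intros)+
  moreover have "eventually (\<lambda>t::real. t \<in> {0<..<1}) (at_left 1)"
    by (rule eventually_at_leftI[of 0]) auto
  then have "eventually (\<lambda>t. t * norm (deriv h 0) \<le> 1 - (t * norm (h 0))\<^sup>2) (at_left 1)"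
    by eventually_elim (use scaled in auto)
  ultimately show ?thesis
    using tendsto_le[of "at_left (1::real)"] by fastforce
qed

text \<open>Geometric sum whose ratio is an \<open>n\<close>-th root of unity, equal to 1 exactly
  when \<open>n\<close> divides \<open>m\<close>. It serves as a filter for the exponents divisible
  by \<open>n\<close>.\<close>

lemma sum_unity_root_powers:
  assumes "n > 0"
  shows "(\<Sum>j<n. exp (2 * of_real pi * \<i> * of_nat m / of_nat n) ^ j)
    = (if n dvd m then of_nat n else (0::complex))"
proof -
  define u where "u = exp (2 * of_real pi * \<i> * of_nat m / of_nat n :: complex)"
  have "u = 1 \<longleftrightarrow> n dvd m"
    unfolding u_def using assms by (intro complex_root_unity_eq_1) auto
  moreover have "u ^ n = 1"
    unfolding u_def using assms by (intro complex_root_unity) auto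
  ultimately show ?thesis
    unfolding u_def[symmetric] by (auto simp: geometric_sum)
qed

text \<open>Averaging \<open>f\<close> over the rotations by \<open>n\<close>-th roots of unity leaves the bounded function
  \<open>\<Sum>k. a\<^bsub>nk\<^esub> z\<^bsup>nk\<^esup>\<close> of \<open>z\<^bsup>n\<^esup>\<close>, whose derivative at the origin is \<open>a\<^sub>n\<close>.\<close>

lemma power_series_multiples:
  assumes ser: "\<And>z. norm z < 1 \<Longrightarrow> (\<lambda>n. a n * z ^ n) sums f z"
    and le: "\<And>z::complex. norm z < 1 \<Longrightarrow> norm (f z) \<le> 1"
    and n: "n > 0" and w: "norm w < 1"
  obtains s where "(\<lambda>k. a (n * k) * w ^ k) sums s" "norm s \<le> 1"
proof -
  define \<omega> where "\<omega> = exp (2 * of_real pi * \<i> / of_nat n :: complex)"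
  obtain z where z: "z ^ n = w"
    using exists_complex_root[of n w] n by auto
  have z1: "norm z < 1"
  proof (rule ccontr)
    assume "\<not> norm z < 1"
    then have "norm z ^ n \<ge> 1" by (simp add: one_le_power)
    then show False using w z by (simp add: norm_power[symmetric])
  qed
  have \<omega>_norm: "norm (\<omega> ^ j) = 1" for j
    by (simp add: \<omega>_def norm_power)
  have \<omega>_pow: "(\<omega> ^ j) ^ m = exp (2 * of_real pi * \<i> * of_nat m / of_nat n) ^ j" for j m
  proof -
    have "\<omega> ^ m = exp (of_nat m * (2 * of_real pi * \<i> / of_nat n))"
      unfolding \<omega>_def by (simp only: exp_of_nat_mult)
    also have "\<dots> = exp (2 * of_real pi * \<i> * of_nat m / of_nat n)"
      by (simp add: mult.commute)
    finally show ?thesis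
      by (metis power_mult mult.commute)
  qed
  \<comment> \<open>Add the \<open>n\<close> rotated series term by term; in each term the powers of
    \<omega> add up to \<open>n\<close> or to 0.\<close>
  have "(\<lambda>m. \<Sum>j<n. a m * (\<omega> ^ j * z) ^ m) sums (\<Sum>j<n. f (\<omega> ^ j * z))"
    by (intro sums_sum ser) (simp add: norm_mult \<omega>_norm z1)
  moreover have "(\<Sum>j<n. a m * (\<omega> ^ j * z) ^ m) = of_nat n * (if n dvd m then a m * z ^ m else 0)" for m
  proof -
    have "(\<Sum>j<n. a m * (\<omega> ^ j * z) ^ m) = a m * z ^ m * (\<Sum>j<n. (\<omega> ^ j) ^ m)"
      by (simp add: power_mult_distrib sum_distrib_left mult_ac)
    then show ?thesis
      by (simp add: \<omega>_pow sum_unity_root_powers[OF n])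
  qed
  ultimately have "(\<lambda>m. of_nat n * (if n dvd m then a m * z ^ m else 0)) sums (\<Sum>j<n. f (\<omega> ^ j * z))"
    by simp
  from sums_divide[OF this, of "of_nat n"]
  have av: "(\<lambda>m. if n dvd m then a m * z ^ m else 0) sums ((\<Sum>j<n. f (\<omega> ^ j * z)) / of_nat n)"
    using n by simp
  \<comment> \<open>The surviving indices are the multiples of \<open>n\<close>; since all other
    terms are 0, reindexing by \<open>n * k\<close> keeps the sum.\<close>
  have mono: "strict_mono (\<lambda>k. n * k)"
    using n by (simp add: strict_mono_def)
  have "(\<lambda>k. if n dvd n * k then a (n * k) * z ^ (n * k) else 0)
      sums ((\<Sum>j<n. f (\<omega> ^ j * z)) / of_nat n)"
    using av by (subst sums_mono_reindex[OF mono]) (auto elim!: dvdE)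
  then have 1: "(\<lambda>k. a (n * k) * w ^ k) sums ((\<Sum>j<n. f (\<omega> ^ j * z)) / of_nat n)"
    by (simp add: power_mult z)
  have "norm (\<Sum>j<n. f (\<omega> ^ j * z)) \<le> (\<Sum>j<n. 1)"
    by (intro sum_norm_le le) (simp add: norm_mult \<omega>_norm z1)
  then have "norm ((\<Sum>j<n. f (\<omega> ^ j * z)) / of_nat n) \<le> 1"
    using n by (simp add: norm_divide)
  with 1 show ?thesis by (rule that)
qed

text \<open>The averaged series, read as a function \<open>h\<close> of \<open>w = z ^ n\<close>,
  turns the \<open>n\<close>-th coefficient into a first one, while \<open>h 0\<close> is still
  \<open>a 0\<close>; Schwarz-Pick then applies to \<open>h\<close>.\<close>

lemma bounded_power_series_coeff_le:
  assumes ser: "\<And>z. norm z < 1 \<Longrightarrow> (\<lambda>n. a n * z ^ n) sums f z"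
    and le: "\<And>z::complex. norm z < 1 \<Longrightarrow> norm (f z) \<le> 1"
    and n: "n > 0"
  shows "norm (a n) \<le> 1 - (norm (a 0))\<^sup>2"
proof -
  define h where "h = (\<lambda>w. \<Sum>k. a (n * k) * w ^ k)"
  have h: "(\<lambda>k. a (n * k) * w ^ k) sums h w \<and> norm (h w) \<le> 1" if w: "norm w < 1" for w
  proof -
    obtain s where s: "(\<lambda>k. a (n * k) * w ^ k) sums s" "norm s \<le> 1"
      using power_series_multiples[OF ser le n w] by blast
    then have "h w = s"
      unfolding h_def by (simp add: sums_iff)
    then show ?thesis using s by simp
  qed
  have "h holomorphic_on ball 0 1"
    by (rule power_series_holomorphic[where a = "\<lambda>k. a (n * k)"]) (use h in auto)
  then have "norm (deriv h 0) \<le> 1 - (norm (h 0))\<^sup>2"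
    by (rule Schwarz_Pick_coeff) (use h in blast)
  moreover have "h 0 = a 0"
    unfolding h_def using powser_zero[of "\<lambda>k. a (n * k)"] by simp
  moreover have "(h has_field_derivative (\<Sum>k. diffs (\<lambda>k. a (n * k)) k * 0 ^ k)) (at 0)"
    unfolding h_def
    \<comment> \<open>Any nonzero point of the disk would do in place of 1/2: convergence there
      allows termwise differentiation at 0.\<close>
    by (rule termdiffs_strong[of _ "1/2"]) (use h[of "1/2"] in \<open>auto simp: sums_iff\<close>)
  then have "deriv h 0 = a n"
    unfolding powser_zero by (simp add: DERIV_imp_deriv diffs_def)
  ultimately show ?thesis by simp
qed

section \<open>The logarithmic series and its critical radius\<close>

lemma log_tail_sums:
  fixes r :: real
  assumes "0 < r" "r < 1"
  shows "(\<lambda>n. r ^ (n + 1) / (real n + 2)) sums (- ln (1 - r) / r - 1)"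
proof -
  have "(\<lambda>n. - (r ^ n) / real n) sums ln (1 - r)"
    using ln_series'[of "- r"] assms by simp
  \<comment> \<open>The term for index 0 is 0 because division by 0 yields 0, so dropping two terms
    only removes \<open>- r\<close>.\<close>
  from sums_split_initial_segment[OF this, of 2]
  have "(\<lambda>n. - (r ^ (n + 2)) / real (n + 2)) sums (ln (1 - r) + r)"
    by (simp add: eval_nat_numeral)
  from sums_divide[OF this, of "- r"]
  have "(\<lambda>n. - (r ^ (n + 2)) / real (n + 2) / (- r)) sums ((ln (1 - r) + r) / (- r))" .
  moreover have "- (r ^ (n + 2)) / real (n + 2) / (- r) = r ^ (n + 1) / (real n + 2)" for n
  proof -
    have "- (r ^ (n + 2)) / real (n + 2) / (- r) = r * r ^ (n + 1) / (real n + 2) / r"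
      by simp
    then show ?thesis using assms by simp
  qed
  moreover have "(ln (1 - r) + r) / (- r) = - ln (1 - r) / r - 1"
    using assms by (simp add: field_simps)
  ultimately show ?thesis by simp
qed

text \<open>In the power series of \<open>log_tail_sums\<close> every term is strictly increasing in
  the variable, so the series of differences has positive terms.\<close>

lemma log_tail_strict_mono:
  fixes x y :: real
  assumes "0 < x" "x < y" "y < 1"
  shows "- ln (1 - x) / x - 1 < - ln (1 - y) / y - 1"
proof -
  let ?d = "\<lambda>n. y ^ (n + 1) / (real n + 2) - x ^ (n + 1) / (real n + 2)"
  have d: "?d sums ((- ln (1 - y) / y - 1) - (- ln (1 - x) / x - 1))"
    using assms by (intro sums_diff log_tail_sums) auto
  have "0 < suminf ?d"
  proof (rule suminf_pos)
    show "summable ?d" using d by (rule sums_summable)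
    show "0 < ?d n" for n
      using power_strict_mono[of x y "n + 1"] assms by (simp add: divide_strict_right_mono)
  qed
  then show ?thesis
    using sums_unique[OF d] by simp
qed

lemma log_equation_root:
  obtains R :: real where "0.5828 \<le> R" "R < 0.5829" "3 * R + 2 * ln (1 - R) = 0"
proof -
  let ?g = "\<lambda>x::real. 3 * x + 2 * ln (1 - x)"
  \<comment> \<open>Passing to the reciprocal makes the argument exceed 1, as suits
    \<open>ln_approx_bounds\<close>; the fractions below are \<open>1 / (1 - x)\<close> at the two
    decimal endpoints.\<close>
  have ln_inv: "ln (1 - x) = - ln (1 / (1 - x))" if "x < 1" for x :: real
    using that by (simp add: ln_div)
  have lo: "0 < ?g 0.5828"
    using ln_approx_bounds[of "10000 / 4172" 6] ln_inv[of "0.5828"]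
    by (simp add: lessThan_nat_numeral lessThan_Suc power_divide)
  have hi: "?g 0.5829 < 0"
    using ln_approx_bounds[of "10000 / 4171" 6] ln_inv[of "0.5829"]
    by (simp add: lessThan_nat_numeral lessThan_Suc power_divide)
  have "\<exists>x\<ge>0.5828. x \<le> 0.5829 \<and> ?g x = 0"
    by (rule IVT2') (use lo hi in \<open>auto intro!: continuous_intros\<close>)
  then obtain R where "0.5828 \<le> R" "R \<le> 0.5829" "?g R = 0"
    by blast
  moreover from this hi have "R \<noteq> 0.5829" by (metis less_irrefl)
  ultimately show ?thesis using that by force
qed

section \<open>The inequality and its sharpness\<close>

text \<open>Summability is stated for all \<open>r < 1\<close>, apart from the bound, because the
  sharpness argument uses it beyond the critical radius. The bound asks for \<open>0 < r\<close>
  because the closed form of the tail divides by \<open>r\<close>.\<close>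

lemma weighted_coeff_sum_le_1:
  fixes r :: real
  assumes ser: "\<And>z. norm z < 1 \<Longrightarrow> (\<lambda>n. a n * z ^ n) sums f z"
    and le: "\<And>z::complex. norm z < 1 \<Longrightarrow> norm (f z) \<le> 1"
    and r: "0 \<le> r" "r < 1"
  shows "summable (\<lambda>n. norm (a n) / (real n + 1) * r ^ n)"
    and "0 < r \<Longrightarrow> - ln (1 - r) / r - 1 \<le> 1 / 2 \<Longrightarrow>
      (\<Sum>n. norm (a n) / (real n + 1) * r ^ n) \<le> 1"
proof -
  let ?t = "\<lambda>n. norm (a n) / (real n + 1) * r ^ n"
  have a0: "norm (a 0) \<le> 1"
    using ser[of 0] le[of 0] powser_zero[of a] by (simp add: sums_iff)
  have coeff: "norm (a (Suc n)) \<le> 1 - (norm (a 0))\<^sup>2" for n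
    by (rule bounded_power_series_coeff_le[OF ser le]) auto
  have a1: "norm (a n) \<le> 1" for n
    using a0 coeff order_trans[OF coeff, of 1] by (cases n) auto
  show sm: "summable ?t"
  proof (rule summable_comparison_test'[of "\<lambda>n. r ^ n" 0])
    show "summable (\<lambda>n. r ^ n)"
      using r by (intro summable_geometric) auto
    show "norm (?t n) \<le> r ^ n" for n
    proof -
      have "norm (a n) / (real n + 1) \<le> 1"
        using a1[of n] by (simp add: divide_simps)
      then show ?thesis
        using r mult_right_mono[of "norm (a n) / (real n + 1)" 1 "r ^ n"] by simp
    qed
  qed
  assume "0 < r" and S: "- ln (1 - r) / r - 1 \<le> 1 / 2"
  let ?A = "norm (a 0)" and ?S = "- ln (1 - r) / r - 1"
  have A2: "0 \<le> 1 - ?A\<^sup>2"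
    using a0 by (simp add: power_le_one)
  have tail: "(\<lambda>n. (1 - ?A\<^sup>2) * (r ^ (n + 1) / (real n + 2))) sums ((1 - ?A\<^sup>2) * ?S)"
    using \<open>0 < r\<close> r by (intro sums_mult log_tail_sums) auto
  have "suminf ?t = ?A + (\<Sum>n. ?t (Suc n))"
    using suminf_split_head[OF sm] by simp
  also have "(\<Sum>n. ?t (Suc n)) \<le> (\<Sum>n. (1 - ?A\<^sup>2) * (r ^ (n + 1) / (real n + 2)))"
  proof (rule suminf_le)
    show "summable (\<lambda>n. ?t (Suc n))"
      using sm by (subst summable_Suc_iff)
    show "?t (Suc n) \<le> (1 - ?A\<^sup>2) * (r ^ (n + 1) / (real n + 2))" for n
    proof -
      have "?t (Suc n) = norm (a (Suc n)) * (r ^ (n + 1) / (real n + 2))"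
        by (simp add: add.commute)
      also have "\<dots> \<le> (1 - ?A\<^sup>2) * (r ^ (n + 1) / (real n + 2))"
        using r by (intro mult_right_mono coeff) auto
      finally show ?thesis .
    qed
  qed (use tail in \<open>rule sums_summable\<close>)
  also have "\<dots> = (1 - ?A\<^sup>2) * ?S"
    using tail by (rule sums_unique[symmetric])
  also have "?A + \<dots> \<le> ?A + (1 - ?A\<^sup>2) * (1 / 2)"
    using A2 S by (intro add_left_mono mult_left_mono)
  also have "\<dots> = 1 - (1 - ?A)\<^sup>2 / 2"
    by (simp add: power2_eq_square field_simps)
  also have "\<dots> \<le> 1"
    by simp
  finally show "suminf ?t \<le> 1" by simp
qed

text \<open>Nearly extremal functions: for \<open>n > 0\<close> the ratio of
  \<open>norm (a n)\<close> to the Schwarz-Pick bound \<open>1 - c\<^sup>2\<close> is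
  \<open>c ^ (n - 1)\<close>, which tends to 1 with \<open>c\<close>.\<close>

lemma moebius_power_series:
  fixes c :: real
  assumes c: "0 \<le> c" "c < 1"
  defines "f \<equiv> \<lambda>z. (of_real c - z) / (1 - of_real c * z)"
    and "a \<equiv> \<lambda>n. if n = 0 then of_real c else - of_real ((1 - c\<^sup>2) * c ^ (n - 1))"
  shows "f \<in> unit_disk_class" and "power_series_on_disk a f"
proof -
  have f: "f = (\<lambda>z. - Moebius_function 0 (of_real c) z)"
    by (simp add: f_def Moebius_function_simple minus_divide_left)
  have c1: "norm (of_real c :: complex) < 1"
    using c by simp
  have "f holomorphic_on ball 0 1"
    unfolding f by (intro holomorphic_intros Moebius_function_holomorphic c1)
  moreover have "norm (f z) \<le> 1" if "norm z < 1" for z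
    unfolding f norm_minus_cancel by (rule less_imp_le[OF Moebius_function_norm_lt_1[OF c1 that]])
  ultimately show "f \<in> unit_disk_class"
    by (auto simp: unit_disk_class_def analytic_on_open)
  show "power_series_on_disk a f"
    unfolding power_series_on_disk_def
  proof
    fix z :: complex assume "z \<in> ball 0 1"
    then have "norm z < 1" by simp
    then have lt: "norm (of_real c * z) < 1"
      using c mult_strict_mono'[of c 1 "norm z" 1] by (simp add: norm_mult)
    then have nz: "1 - of_real c * z \<noteq> 0" by force
    \<comment> \<open>Subtracting the constant term leaves
      \<open>f z - c = - (1 - c\<^sup>2) * z / (1 - c * z)\<close>, a geometric series.\<close>
    have "(\<lambda>n. - (of_real (1 - c\<^sup>2) * z) * (of_real c * z) ^ n)
        sums (- (of_real (1 - c\<^sup>2) * z) * (1 / (1 - of_real c * z)))"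
      by (intro sums_mult geometric_sums lt)
    moreover have "- (of_real (1 - c\<^sup>2) * z) * (1 / (1 - of_real c * z)) = f z - a 0 * z ^ 0"
      using nz by (simp add: f_def a_def field_simps power2_eq_square)
    moreover have "- (of_real (1 - c\<^sup>2) * z) * (of_real c * z) ^ n = a (Suc n) * z ^ Suc n" for n
      by (simp add: a_def power_mult_distrib mult_ac)
    ultimately have "(\<lambda>n. a (Suc n) * z ^ Suc n) sums (f z - a 0 * z ^ 0)" by simp
    then show "(\<lambda>n. a n * z ^ n) sums f z"
      by (subst (asm) sums_Suc_iff) simp
  qed
qed

text \<open>The tail is first cut at an \<open>N\<close> whose partial sum already exceeds 1/2. Only
  finitely many terms then depend on \<open>c\<close>, so letting \<open>c\<close> tend to 1 needs
  no exchange of limits.\<close>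

lemma weighted_coeff_sum_gt_1:
  fixes r :: real
  assumes r: "0 < r" "r < 1" and S: "- ln (1 - r) / r - 1 > 1 / 2"
  obtains f a where "f \<in> unit_disk_class" "power_series_on_disk a f"
    "(\<Sum>n. norm (a n) / (real n + 1) * r ^ n) > 1"
proof -
  have "(\<lambda>N. \<Sum>k<N. r ^ (k + 1) / (real k + 2)) \<longlonglongrightarrow> (- ln (1 - r) / r - 1)"
    using log_tail_sums[OF r] by (simp add: sums_def)
  from order_tendstoD(1)[OF this S]
  obtain N where N: "(\<Sum>k<N. r ^ (k + 1) / (real k + 2)) > 1 / 2"
    by (auto simp: eventually_sequentially)
  \<comment> \<open>Since \<open>1 - c\<^sup>2 = (1 - c) * (1 + c)\<close>, the first
    \<open>N + 1\<close> weighted terms add up to \<open>c + (1 - c) * p c\<close>, which exceeds 1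
    as soon as \<open>p c > 1\<close>.\<close>
  define p where "p = (\<lambda>c. (1 + c) * (\<Sum>k<N. c ^ k * (r ^ (k + 1) / (real k + 2))))"
  have "(p \<longlongrightarrow> p 1) (at_left 1)"
    unfolding p_def by (intro tendsto_intros)
  moreover have "p 1 > 1"
    using N by (simp add: p_def)
  ultimately have "eventually (\<lambda>c. p c > 1) (at_left 1)"
    by (rule order_tendstoD(1))
  moreover have "eventually (\<lambda>c::real. c \<in> {0<..<1}) (at_left 1)"
    by (rule eventually_at_leftI[of 0]) auto
  ultimately have "eventually (\<lambda>c. p c > 1 \<and> c \<in> {0<..<1}) (at_left (1::real))"
    by (rule eventually_conj)
  then obtain c where c: "p c > 1" "0 < c" "c < 1"
    using eventually_happens by fastforce
  define f :: "complex \<Rightarrow> complex" where "f = (\<lambda>z. (of_real c - z) / (1 - of_real c * z))"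
  define a :: "nat \<Rightarrow> complex" where
    "a = (\<lambda>n. if n = 0 then of_real c else - of_real ((1 - c\<^sup>2) * c ^ (n - 1)))"
  have f: "f \<in> unit_disk_class" and a: "power_series_on_disk a f"
    unfolding f_def a_def using moebius_power_series[of c] c by auto
  let ?t = "\<lambda>n. norm (a n) / (real n + 1) * r ^ n"
  have sm: "summable ?t"
    by (rule weighted_coeff_sum_le_1(1)[of a f])
      (use f a r in \<open>auto simp: unit_disk_class_def power_series_on_disk_def\<close>)
  have c2: "0 \<le> 1 - c\<^sup>2"
    using c by (simp add: power_le_one)
  have a_Suc: "norm (a (Suc k)) = (1 - c\<^sup>2) * c ^ k" for k
    using c c2 by (simp add: a_def norm_mult norm_power del: of_real_mult of_real_diff of_real_power)
  have "(\<Sum>n<Suc N. ?t n) = c + (\<Sum>k<N. ?t (Suc k))"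
    using c by (subst sum.lessThan_Suc_shift) (simp add: a_def)
  also have "(\<Sum>k<N. ?t (Suc k)) = (1 - c\<^sup>2) * (\<Sum>k<N. c ^ k * (r ^ (k + 1) / (real k + 2)))"
    unfolding sum_distrib_left by (intro sum.cong) (simp_all add: a_Suc add.commute)
  also have "\<dots> = (1 - c) * p c"
    by (simp add: p_def power2_eq_square algebra_simps)
  also have "c + (1 - c) * p c > c + (1 - c) * 1"
    using c by (intro add_strict_left_mono mult_strict_left_mono) auto
  finally have "1 < (\<Sum>n<Suc N. ?t n)" by simp
  also have "\<dots> \<le> suminf ?t"
    using r by (intro sum_le_suminf sm) auto
  finally show ?thesis
    using that f a by blast
qed

theorem corollary2p3:
  "\<exists>R::real. 0 < R \<and> R < 1 \<and>
     (\<forall>x. 0 < x \<and> x < 1 \<longrightarrow> (3 * x + 2 * ln (1 - x) = 0 \<longleftrightarrow> x = R)) \<and>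
     0.5828 \<le> R \<and> R < 0.5829 \<and>
     (\<forall>f \<in> unit_disk_class. \<forall>a. power_series_on_disk a f \<longrightarrow>
        (\<forall>r. 0 \<le> r \<and> r \<le> R \<longrightarrow>
           summable (\<lambda>n. norm (a n) / (real n + 1) * r ^ n) \<and>
           (\<Sum>n. norm (a n) / (real n + 1) * r ^ n) \<le> 1)) \<and>
     \<not> (\<exists>R'. R < R' \<and> R' < 1 \<and>
        (\<forall>f \<in> unit_disk_class. \<forall>a. power_series_on_disk a f \<longrightarrow>
           (\<forall>r. 0 \<le> r \<and> r \<le> R' \<longrightarrow>
              (\<Sum>n. norm (a n) / (real n + 1) * r ^ n) \<le> 1)))"
proof -
  let ?S = "\<lambda>x::real. - ln (1 - x) / x - 1"
  obtain R :: real where R: "0.5828 \<le> R" "R < 0.5829" "3 * R + 2 * ln (1 - R) = 0"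
    by (rule log_equation_root)
  then have R01: "0 < R" "R < 1" by auto
  \<comment> \<open>Division by \<open>2 * x\<close> turns the equation into a level set of the
    strictly increasing \<open>?S\<close>, whence uniqueness of the root.\<close>
  have root_iff: "3 * x + 2 * ln (1 - x) = 0 \<longleftrightarrow> ?S x = 1 / 2" if "0 < x" for x
    using that by (auto simp: field_simps)
  have SR: "?S R = 1 / 2"
    using root_iff R01 R(3) by blast
  have unique: "3 * x + 2 * ln (1 - x) = 0 \<longleftrightarrow> x = R" if "0 < x" "x < 1" for x
    using root_iff[OF that(1)] SR log_tail_strict_mono[of x R] log_tail_strict_mono[of R x] that R01
    by (cases x R rule: linorder_cases) auto
  have inside: "summable (\<lambda>n. norm (a n) / (real n + 1) * r ^ n) \<and>
      (\<Sum>n. norm (a n) / (real n + 1) * r ^ n) \<le> 1"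
    if fa: "f \<in> unit_disk_class" "power_series_on_disk a f" and r: "0 \<le> r" "r \<le> R" for f a r
  proof -
    have ser: "(\<lambda>n. a n * z ^ n) sums f z" and le: "norm (f z) \<le> 1" if "norm z < 1" for z
      using fa that by (auto simp: unit_disk_class_def power_series_on_disk_def)
    have r1: "r < 1" using r R01 by simp
    show ?thesis
    \<comment> \<open>At \<open>r = 0\<close> the closed form \<open>?S\<close> is not the tail sum;
      there the series is just its first term, since \<open>0 ^ 0 = 1\<close>.\<close>
    proof (cases "r = 0")
      case True
      have "norm (a 0) \<le> 1"
        using ser[of 0] le[of 0] powser_zero[of a] by (simp add: sums_iff)
      then show ?thesis
        using True weighted_coeff_sum_le_1(1)[OF ser le r(1) r1]
          powser_zero[of "\<lambda>n. norm (a n) / (real n + 1)"] by simp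
    next
      case False
      then have "0 < r" using r by simp
      moreover have "?S r \<le> 1 / 2"
        using SR log_tail_strict_mono[of r R] \<open>0 < r\<close> r R01 by (cases "r = R") auto
      ultimately show ?thesis
        using weighted_coeff_sum_le_1[OF ser le r(1) r1] by blast
    qed
  qed
  \<comment> \<open>The inequality already fails at the right endpoint \<open>r = R'\<close>, which
    is enough to refute any larger radius.\<close>
  have sharp: "\<exists>f \<in> unit_disk_class. \<exists>a. power_series_on_disk a f \<and>
      \<not> (\<Sum>n. norm (a n) / (real n + 1) * R' ^ n) \<le> 1" if R': "R < R'" "R' < 1" for R'
  proof -
    have "?S R' > 1 / 2"
      using log_tail_strict_mono[of R R'] SR R' R01 by simp
    then obtain f a where "f \<in> unit_disk_class" "power_series_on_disk a f"
      "(\<Sum>n. norm (a n) / (real n + 1) * R' ^ n) > 1"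
      using weighted_coeff_sum_gt_1[of R'] R' R01 by auto
    then show ?thesis by force
  qed
  have best: "\<not> (\<exists>R'. R < R' \<and> R' < 1 \<and>
        (\<forall>f \<in> unit_disk_class. \<forall>a. power_series_on_disk a f \<longrightarrow>
           (\<forall>r. 0 \<le> r \<and> r \<le> R' \<longrightarrow>
              (\<Sum>n. norm (a n) / (real n + 1) * r ^ n) \<le> 1)))"
  proof (rule notI, elim exE conjE)
    fix R' assume R': "R < R'" "R' < 1"
      and all: "\<forall>f \<in> unit_disk_class. \<forall>a. power_series_on_disk a f \<longrightarrow>
           (\<forall>r. 0 \<le> r \<and> r \<le> R' \<longrightarrow> (\<Sum>n. norm (a n) / (real n + 1) * r ^ n) \<le> 1)"
    from sharp[OF R'] obtain f a where "f \<in> unit_disk_class" "power_series_on_disk a f"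
      and gt: "\<not> (\<Sum>n. norm (a n) / (real n + 1) * R' ^ n) \<le> 1" by blast
    moreover have "0 \<le> R'" using R' R01 by simp
    ultimately show False using all by blast
  qed
  show ?thesis
    by (intro exI[of _ R] conjI R01 R(1,2) best; use unique inside in simp)
qed

end
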